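(* Consider a bipartite network coordination game with player groups $\{1,\dots,n\}$ and $\{1,\dots,m\}$, real payoff matrices $A^{ij}$ of size $k_i\times l_j$ and learning rates $\eta_1,\eta_2>0$ (the two-agent coordination game with payoff matrix $A$ being the case $n=m=1$), and suppose the players update their strategies $\mathbf x_i\in\mathbb R^{k_i}$, $\mathbf y_j\in\mathbb R^{l_j}$ by Alternating Gradient Ascent: $$\mathbf x_i^{t+1}=\mathbf x_i^t+\eta_1\sum_{j=1}^m A^{ij}\mathbf y_j^t,\qquad \mathbf y_j^{t+1}=\mathbf y_j^t+\eta_2\sum_{i=1}^n (A^{ij})^{\top}\mathbf x_i^{t+1}.$$ Let $T$ be the resulting map $(X^t,Y^t)\mapsto(X^{t+1},Y^{t+1})$ on the strategy space $\prod_i\mathbb R^{k_i}\times\prod_j\mathbb R^{l_j}$, where $X=(\mathbf x_1,\dots,\mathbf x_n)$, $Y=(\mathbf y_1,\dots,\mathbf y_m)$. Then every (maximal) scrambled set of $T$ has Lebesgue measure zero in the strategy space.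
   Context: A pair of points $u,v$ is called scrambled for $T$ if $\liminf_{k\to\infty}\|T^k(u)-T^k(v)\|=0$ and $\limsup_{k\to\infty}\|T^k(u)-T^k(v)\|>0$. A set $S$ is scrambled if every pair of distinct points of $S$ is scrambled. *)

theory Defs
  imports "HOL-Analysis.Analysis"
begin

text \<open>
  Strategies of one side of the network are functions \<open>x i a\<close>: the \<open>a\<close>-th coordinate of the
  strategy of player \<open>i\<close>.  Since the dimension depends on the player, points are
  represented extensionally (value \<open>undefined\<close> outside the index range), so that a point is
  determined by its coordinates and the sets below are genuine products of the \<open>\<real>\<^sup>d\<close>.
\<close>

type_synonym profile = "nat \<Rightarrow> nat \<Rightarrow> real"

definition profile_space :: "nat \<Rightarrow> (nat \<Rightarrow> nat) \<Rightarrow> profile set" where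
  "profile_space n d = (\<Pi>\<^sub>E i\<in>{1..n}. \<Pi>\<^sub>E a\<in>{1..d i}. UNIV)"

definition strategy_space ::
    "nat \<Rightarrow> nat \<Rightarrow> (nat \<Rightarrow> nat) \<Rightarrow> (nat \<Rightarrow> nat) \<Rightarrow> (profile \<times> profile) set" where
  "strategy_space n m k l = profile_space n k \<times> profile_space m l"

definition profile_borel :: "nat \<Rightarrow> (nat \<Rightarrow> nat) \<Rightarrow> profile measure" where
  "profile_borel n d = (\<Pi>\<^sub>M i\<in>{1..n}. \<Pi>\<^sub>M a\<in>{1..d i}. lborel)"

text \<open>Lebesgue measure is the completion of the product Borel measure, as for \<^const>\<open>lebesgue\<close>.\<close>

definition strategy_lebesgue ::
    "nat \<Rightarrow> nat \<Rightarrow> (nat \<Rightarrow> nat) \<Rightarrow> (nat \<Rightarrow> nat) \<Rightarrow> (profile \<times> profile) measure" where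
  "strategy_lebesgue n m k l = completion (profile_borel n k \<Otimes>\<^sub>M profile_borel m l)"

lemma space_strategy_lebesgue: "space (strategy_lebesgue n m k l) = strategy_space n m k l"
  by (simp add: strategy_lebesgue_def strategy_space_def profile_borel_def profile_space_def
      space_pair_measure space_PiM)

text \<open>The Euclidean distance \<open>\<parallel>u - v\<parallel>\<close> on the strategy space.\<close>

definition strategy_dist ::
    "nat \<Rightarrow> nat \<Rightarrow> (nat \<Rightarrow> nat) \<Rightarrow> (nat \<Rightarrow> nat) \<Rightarrow> profile \<times> profile \<Rightarrow> profile \<times> profile \<Rightarrow> real" where
  "strategy_dist n m k l u v =
     sqrt ((\<Sum>i=1..n. \<Sum>a=1..k i. (fst u i a - fst v i a)\<^sup>2)
         + (\<Sum>j=1..m. \<Sum>b=1..l j. (snd u j b - snd v j b)\<^sup>2))"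

text \<open>\<open>A i j a b\<close> is the entry of the payoff matrix \<open>A\<^sup>i\<^sup>j\<close> in row \<open>a\<close> and column \<open>b\<close>.
  In \<open>alt_gradient\<close>, the second group responds to the already updated first group.\<close>

definition update_X ::
    "nat \<Rightarrow> nat \<Rightarrow> (nat \<Rightarrow> nat) \<Rightarrow> (nat \<Rightarrow> nat) \<Rightarrow> (nat \<Rightarrow> nat \<Rightarrow> nat \<Rightarrow> nat \<Rightarrow> real) \<Rightarrow> real
      \<Rightarrow> profile \<Rightarrow> profile \<Rightarrow> profile" where
  "update_X n m k l A \<eta> X Y =
     (\<lambda>i\<in>{1..n}. \<lambda>a\<in>{1..k i}. X i a + \<eta> * (\<Sum>j=1..m. \<Sum>b=1..l j. A i j a b * Y j b))"

definition update_Y ::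
    "nat \<Rightarrow> nat \<Rightarrow> (nat \<Rightarrow> nat) \<Rightarrow> (nat \<Rightarrow> nat) \<Rightarrow> (nat \<Rightarrow> nat \<Rightarrow> nat \<Rightarrow> nat \<Rightarrow> real) \<Rightarrow> real
      \<Rightarrow> profile \<Rightarrow> profile \<Rightarrow> profile" where
  "update_Y n m k l A \<eta> X Y =
     (\<lambda>j\<in>{1..m}. \<lambda>b\<in>{1..l j}. Y j b + \<eta> * (\<Sum>i=1..n. \<Sum>a=1..k i. A i j a b * X i a))"

definition alt_gradient ::
    "nat \<Rightarrow> nat \<Rightarrow> (nat \<Rightarrow> nat) \<Rightarrow> (nat \<Rightarrow> nat) \<Rightarrow> (nat \<Rightarrow> nat \<Rightarrow> nat \<Rightarrow> nat \<Rightarrow> real) \<Rightarrow> real \<Rightarrow> real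
      \<Rightarrow> profile \<times> profile \<Rightarrow> profile \<times> profile" where
  "alt_gradient n m k l A \<eta>1 \<eta>2 = (\<lambda>(X, Y).
     let X' = update_X n m k l A \<eta>1 X Y in (X', update_Y n m k l A \<eta>2 X' Y))"

lemma alt_gradient_in_space: "alt_gradient n m k l A \<eta>1 \<eta>2 u \<in> strategy_space n m k l"
  by (simp add: alt_gradient_def update_X_def update_Y_def strategy_space_def profile_space_def
      Let_def split_beta)

text \<open>The distances may be unbounded along an orbit, so the limits are taken in \<^typ>\<open>ereal\<close>.\<close>

definition scrambled_pair :: "('a \<Rightarrow> 'a \<Rightarrow> real) \<Rightarrow> ('a \<Rightarrow> 'a) \<Rightarrow> 'a \<Rightarrow> 'a \<Rightarrow> bool" where
  "scrambled_pair d T u v \<longleftrightarrow>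
     liminf (\<lambda>t. ereal (d ((T ^^ t) u) ((T ^^ t) v))) = 0 \<and>
     limsup (\<lambda>t. ereal (d ((T ^^ t) u) ((T ^^ t) v))) > 0"

definition scrambled_set :: "('a \<Rightarrow> 'a \<Rightarrow> real) \<Rightarrow> ('a \<Rightarrow> 'a) \<Rightarrow> 'a set \<Rightarrow> bool" where
  "scrambled_set d T S \<longleftrightarrow> (\<forall>u\<in>S. \<forall>v\<in>S. u \<noteq> v \<longrightarrow> scrambled_pair d T u v)"

end

theory Submission
  imports Defs
begin

text \<open>
  With respect to the inner product \<open>\<langle>(X, Y), (X', Y')\<rangle> = X \<bullet> X' / \<eta>\<^sub>1 + Y \<bullet> Y' / \<eta>\<^sub>2\<close> the linear
  map \<open>T\<close> is self-adjoint: up to scaling it is \<open>U\<^sup>T U\<close> for the shear \<open>U (X, Y) = (X + B Y, Y)\<close>.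
  Hence \<open>q t = \<langle>T\<^sup>t w, T\<^sup>t w\<rangle>\<close> satisfies \<open>2 q (t + 1) = 2 \<langle>T\<^sup>t w, T\<^sup>t\<^sup>+\<^sup>2 w\<rangle> \<le> q t + q (t + 2)\<close>.
  A convex sequence of nonnegative reals with lower limit 0 is decreasing, hence tends to 0.
  So for \<open>w = u - v\<close> the two conditions of a scrambled pair are incompatible: a scrambled set has
  at most one point.
\<close>

section \<open>Convex sequences of reals\<close>

text \<open>Convexity makes the increments \<open>q (Suc t) - q t\<close> nondecreasing in
  \<open>t\<close>, so once one of them is positive all later ones are.\<close>

lemma convex_seq_increasing:
  fixes q :: "nat \<Rightarrow> real"
  assumes convex: "\<And>t. 2 * q (Suc t) \<le> q t + q (Suc (Suc t))" and up: "q t < q (Suc t)"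
  shows "q t \<le> q (t + s) \<and> q (t + s) < q (Suc (t + s))"
proof (induction s)
  case 0
  then show ?case using up by simp
next
  case (Suc s)
  then show ?case using convex[of "t + s"] by simp
qed

text \<open>A single increase would keep \<open>q\<close> above a positive bound from then on,
  against \<open>small\<close>. So \<open>q\<close> decreases, and one value below \<open>e\<close>
  keeps all later ones there.\<close>

lemma convex_seq_tendsto_zero:
  fixes q :: "nat \<Rightarrow> real"
  assumes nonneg: "\<And>t. q t \<ge> 0"
    and convex: "\<And>t. 2 * q (Suc t) \<le> q t + q (Suc (Suc t))"
    and small: "\<And>e. e > 0 \<Longrightarrow> \<exists>\<^sub>F t in sequentially. q t < e"
  shows "q \<longlonglongrightarrow> 0"
proof -
  have step: "q (Suc t) \<le> q t" for t
  proof (rule ccontr)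
    assume "\<not> q (Suc t) \<le> q t"
    then have up: "q t < q (Suc t)" by simp
    then have "0 < q (Suc t)" using nonneg[of t] by linarith
    then obtain s where s: "s \<ge> Suc t" "q s < q (Suc t)"
      using small unfolding frequently_sequentially by blast
    \<comment> \<open>Growth is restarted one step later: starting at \<open>t\<close>, the lower
      bound would be \<open>q t\<close>, which may be 0, while \<open>q (Suc t)\<close> is
      positive.\<close>
    have "q (Suc t) < q (Suc (Suc t))"
      using convex_seq_increasing[where q=q, OF convex up, of 1] by simp
    then have "q (Suc t) \<le> q (Suc t + (s - Suc t))"
      using convex_seq_increasing[where q=q, OF convex] by blast
    then show False using s by simp
  qed
  then have "decseq q" by (rule decseq_SucI)
  show ?thesis
  proof (rule LIMSEQ_I)
    fix e :: real assume "0 < e"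
    then obtain t where t: "q t < e"
      using small unfolding frequently_sequentially by blast
    show "\<exists>t0. \<forall>t\<ge>t0. norm (q t - 0) < e"
    proof (intro exI allI impI)
      fix s assume "t \<le> s"
      then have "q s \<le> q t" using \<open>decseq q\<close> by (simp add: decseq_def)
      then show "norm (q s - 0) < e" using t nonneg[of s] by simp
    qed
  qed
qed

section \<open>The weighted inner product and the update map\<close>

context
  fixes n m :: nat and k l :: "nat \<Rightarrow> nat" and A :: "nat \<Rightarrow> nat \<Rightarrow> nat \<Rightarrow> nat \<Rightarrow> real"
    and \<eta>1 \<eta>2 :: real
begin

private abbreviation (input) "T \<equiv> alt_gradient n m k l A \<eta>1 \<eta>2"

definition profile_inner :: "nat \<Rightarrow> (nat \<Rightarrow> nat) \<Rightarrow> profile \<Rightarrow> profile \<Rightarrow> real" where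
  "profile_inner r d X Y = (\<Sum>i=1..r. \<Sum>a=1..d i. X i a * Y i a)"

definition weighted_inner :: "profile \<times> profile \<Rightarrow> profile \<times> profile \<Rightarrow> real" where
  "weighted_inner u v =
     profile_inner n k (fst u) (fst v) / \<eta>1 + profile_inner m l (snd u) (snd v) / \<eta>2"

text \<open>Multiplication by the block matrix B with blocks \<open>A i j\<close>;
  \<open>payoff_Y\<close> is multiplication by its transpose.\<close>

definition payoff_X :: "profile \<Rightarrow> profile" where
  "payoff_X Y i a = (\<Sum>j=1..m. \<Sum>b=1..l j. A i j a b * Y j b)"

definition payoff_Y :: "profile \<Rightarrow> profile" where
  "payoff_Y X j b = (\<Sum>i=1..n. \<Sum>a=1..k i. A i j a b * X i a)"

text \<open>The difference is formed at all indices and need not be extensional; only its entries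
  inside the index ranges enter the inner products.\<close>

definition profile_diff :: "profile \<times> profile \<Rightarrow> profile \<times> profile \<Rightarrow> profile \<times> profile" where
  "profile_diff u v = (\<lambda>i a. fst u i a - fst v i a, \<lambda>j b. snd u j b - snd v j b)"

lemma profile_inner_commute: "profile_inner r d X Y = profile_inner r d Y X"
  by (simp add: profile_inner_def mult.commute)

lemma profile_inner_self_nonneg: "profile_inner r d X X \<ge> 0"
  by (auto simp: profile_inner_def intro!: sum_nonneg)

lemma profile_inner_le: "2 * profile_inner r d X Y \<le> profile_inner r d X X + profile_inner r d Y Y"
proof -
  have "2 * (x * y) \<le> x * x + y * y" for x y :: real
    using sum_squares_bound[of x y] by (simp add: power2_eq_square mult.assoc)
  then show ?thesis
    unfolding profile_inner_def sum_distrib_left sum.distrib[symmetric] by (intro sum_mono)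
qed

lemma payoff_adjoint:
  "profile_inner n k (payoff_X Y) X = profile_inner m l Y (payoff_Y X)"
proof -
  have "profile_inner n k (payoff_X Y) X =
      (\<Sum>i=1..n. \<Sum>a=1..k i. \<Sum>j=1..m. \<Sum>b=1..l j. A i j a b * Y j b * X i a)"
    by (simp add: profile_inner_def payoff_X_def sum_distrib_right)
  \<comment> \<open>The range of \<open>a\<close> depends on \<open>i\<close> and that of
    \<open>b\<close> on \<open>j\<close>, so the sums are swapped pairwise, keeping \<open>i\<close>
    outside \<open>a\<close> and \<open>j\<close> outside \<open>b\<close>.\<close>
  also have "\<dots> = (\<Sum>i=1..n. \<Sum>j=1..m. \<Sum>a=1..k i. \<Sum>b=1..l j. A i j a b * Y j b * X i a)"
    by (rule sum.cong[OF refl], rule sum.swap)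
  also have "\<dots> = (\<Sum>j=1..m. \<Sum>i=1..n. \<Sum>b=1..l j. \<Sum>a=1..k i. A i j a b * Y j b * X i a)"
    by (subst sum.swap, intro sum.cong[OF refl], rule sum.swap)
  also have "\<dots> = (\<Sum>j=1..m. \<Sum>b=1..l j. \<Sum>i=1..n. \<Sum>a=1..k i. A i j a b * Y j b * X i a)"
    by (rule sum.cong[OF refl], rule sum.swap)
  also have "\<dots> = profile_inner m l Y (payoff_Y X)"
    by (simp add: profile_inner_def payoff_Y_def sum_distrib_left mult_ac)
  finally show ?thesis .
qed

lemma profile_inner_add_scaled:
  assumes "\<And>i a. i \<in> {1..r} \<Longrightarrow> a \<in> {1..d i} \<Longrightarrow> X i a = Y i a + c * Z i a"
  shows "profile_inner r d X W = profile_inner r d Y W + c * profile_inner r d Z W"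
  using assms
  by (simp add: profile_inner_def sum.distrib sum_distrib_left algebra_simps)

lemma fst_T: "i \<in> {1..n} \<Longrightarrow> a \<in> {1..k i} \<Longrightarrow> fst (T u) i a = fst u i a + \<eta>1 * payoff_X (snd u) i a"
  by (simp add: alt_gradient_def Let_def split_beta update_X_def payoff_X_def)

lemma snd_T:
  "j \<in> {1..m} \<Longrightarrow> b \<in> {1..l j} \<Longrightarrow> snd (T u) j b = snd u j b + \<eta>2 * payoff_Y (fst (T u)) j b"
  by (simp add: alt_gradient_def Let_def split_beta update_Y_def payoff_Y_def)

lemma weighted_inner_commute: "weighted_inner u v = weighted_inner v u"
  by (simp add: weighted_inner_def profile_inner_commute)

text \<open>The weights cancel the learning rates. What T adds to <u, v> is then the two cross terms
  <X_v, B Y_u> and <X_u, B Y_v>, together with \<open>\<eta>1\<close> <B Y_u, B Y_v>, which comes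
  from Y answering the updated X. The total is symmetric in u and v.\<close>

lemma T_self_adjoint:
  assumes "\<eta>1 > 0" "\<eta>2 > 0"
  shows "weighted_inner (T u) v = weighted_inner u (T v)"
proof -
  have X: "profile_inner n k (fst (T u)) Z =
      profile_inner n k (fst u) Z + \<eta>1 * profile_inner n k (payoff_X (snd u)) Z" for u Z
    using fst_T by (rule profile_inner_add_scaled)
  \<comment> \<open>The payoff is moved onto \<open>Z\<close>, so that \<open>X\<close> can expand
    the remaining \<open>fst (T u)\<close>.\<close>
  have Y: "profile_inner m l (snd (T u)) Z =
      profile_inner m l (snd u) Z + \<eta>2 * profile_inner n k (fst (T u)) (payoff_X Z)" for u Z
  proof -
    have "profile_inner m l (snd (T u)) Z =
        profile_inner m l (snd u) Z + \<eta>2 * profile_inner m l (payoff_Y (fst (T u))) Z"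
      using snd_T by (rule profile_inner_add_scaled)
    then show ?thesis
      using payoff_adjoint[of Z "fst (T u)"] by (simp add: profile_inner_commute)
  qed
  have expand: "weighted_inner (T u) v = weighted_inner u v
      + profile_inner n k (fst v) (payoff_X (snd u)) + profile_inner n k (fst u) (payoff_X (snd v))
      + \<eta>1 * profile_inner n k (payoff_X (snd u)) (payoff_X (snd v))" for u v
    unfolding weighted_inner_def X Y
    using assms by (simp add: field_simps profile_inner_commute[of _ _ "payoff_X (snd u)" "fst v"])
  show ?thesis
    unfolding weighted_inner_commute[of u "T v"] expand
    by (simp add: weighted_inner_commute[of u v]
        profile_inner_commute[of _ _ "payoff_X (snd u)" "payoff_X (snd v)"])
qed

lemma weighted_inner_cong:
  assumes "\<And>i a. i \<in> {1..n} \<Longrightarrow> a \<in> {1..k i} \<Longrightarrow> fst u i a = fst u' i a"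
    and "\<And>j b. j \<in> {1..m} \<Longrightarrow> b \<in> {1..l j} \<Longrightarrow> snd u j b = snd u' j b"
  shows "weighted_inner u v = weighted_inner u' v"
  using assms by (simp add: weighted_inner_def profile_inner_def)

text \<open>This is linearity of T, stated under the inner product because the two points may differ
  outside the index ranges, where T returns \<open>undefined\<close>.\<close>

lemma weighted_inner_T_diff:
  "weighted_inner (T (profile_diff u v)) w = weighted_inner (profile_diff (T u) (T v)) w"
proof (rule weighted_inner_cong)
  show X: "fst (T (profile_diff u v)) i a = fst (profile_diff (T u) (T v)) i a"
    if "i \<in> {1..n}" "a \<in> {1..k i}" for i a
    using that
    by (simp add: fst_T profile_diff_def payoff_X_def right_diff_distrib sum_subtractf)
  \<comment> \<open>\<open>payoff_Y\<close> reads only entries inside the ranges, so agreement there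
    gives equality of whole functions.\<close>
  have "payoff_Y (fst (T (profile_diff u v))) = payoff_Y (fst (profile_diff (T u) (T v)))"
    using X by (intro ext) (simp add: payoff_Y_def)
  then show "snd (T (profile_diff u v)) j b = snd (profile_diff (T u) (T v)) j b"
    if "j \<in> {1..m}" "b \<in> {1..l j}" for j b
    using that
    by (simp add: snd_T) (simp add: snd_T profile_diff_def payoff_Y_def right_diff_distrib sum_subtractf)
qed

lemma weighted_inner_self_nonneg:
  "\<eta>1 > 0 \<Longrightarrow> \<eta>2 > 0 \<Longrightarrow> weighted_inner u u \<ge> 0"
  by (simp add: weighted_inner_def profile_inner_self_nonneg)

lemma weighted_inner_le:
  assumes "\<eta>1 > 0" "\<eta>2 > 0"
  shows "2 * weighted_inner u v \<le> weighted_inner u u + weighted_inner v v"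
proof -
  have "2 * profile_inner n k (fst u) (fst v) / \<eta>1 \<le>
      (profile_inner n k (fst u) (fst u) + profile_inner n k (fst v) (fst v)) / \<eta>1"
    using assms by (intro divide_right_mono profile_inner_le) simp
  moreover have "2 * profile_inner m l (snd u) (snd v) / \<eta>2 \<le>
      (profile_inner m l (snd u) (snd u) + profile_inner m l (snd v) (snd v)) / \<eta>2"
    using assms by (intro divide_right_mono profile_inner_le) simp
  ultimately show ?thesis by (simp add: weighted_inner_def add_divide_distrib)
qed

section \<open>Comparison with the Euclidean distance, and scrambled pairs\<close>

lemma strategy_dist_eq:
  "strategy_dist n m k l u v =
     sqrt (profile_inner n k (fst (profile_diff u v)) (fst (profile_diff u v))
         + profile_inner m l (snd (profile_diff u v)) (snd (profile_diff u v)))"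
  by (simp add: strategy_dist_def profile_inner_def profile_diff_def power2_eq_square)

text \<open>Each weight is at most the sum of both. Together with
  \<open>dist_le_weighted_inner\<close> this makes the two norms equivalent.\<close>

lemma weighted_inner_le_dist:
  assumes "\<eta>1 > 0" "\<eta>2 > 0"
  shows "weighted_inner (profile_diff u v) (profile_diff u v) \<le>
    (1 / \<eta>1 + 1 / \<eta>2) * (strategy_dist n m k l u v)\<^sup>2"
  using assms
    profile_inner_self_nonneg[of n k "fst (profile_diff u v)"]
    profile_inner_self_nonneg[of m l "snd (profile_diff u v)"]
  by (simp add: strategy_dist_eq weighted_inner_def algebra_simps)

lemma dist_le_weighted_inner:
  assumes "\<eta>1 > 0" "\<eta>2 > 0"
  shows "strategy_dist n m k l u v \<le>
    sqrt ((\<eta>1 + \<eta>2) * weighted_inner (profile_diff u v) (profile_diff u v))"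
proof -
  define p where "p = profile_inner n k (fst (profile_diff u v)) (fst (profile_diff u v))"
  define r where "r = profile_inner m l (snd (profile_diff u v)) (snd (profile_diff u v))"
  have "p \<ge> 0" "r \<ge> 0" by (simp_all add: p_def r_def profile_inner_self_nonneg)
  then have "p + r \<le> (p + \<eta>2 * (p / \<eta>1)) + (\<eta>1 * (r / \<eta>2) + r)"
    using assms by (intro add_mono) simp_all
  also have "\<dots> = (\<eta>1 + \<eta>2) * (p / \<eta>1 + r / \<eta>2)"
    using assms by (simp add: field_simps)
  finally show ?thesis by (simp add: strategy_dist_eq weighted_inner_def p_def r_def)
qed

lemma not_scrambled_pair:
  assumes pos: "\<eta>1 > 0" "\<eta>2 > 0"
  shows "\<not> scrambled_pair (strategy_dist n m k l) T u v"
proof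
  define w where "w t = profile_diff ((T ^^ t) u) ((T ^^ t) v)" for t
  define q where "q t = weighted_inner (w t) (w t)" for t
  define d where "d t = strategy_dist n m k l ((T ^^ t) u) ((T ^^ t) v)" for t
  assume "scrambled_pair (strategy_dist n m k l) T u v"
  then have inf: "liminf (\<lambda>t. ereal (d t)) = 0" and sup: "limsup (\<lambda>t. ereal (d t)) > 0"
    by (simp_all add: scrambled_pair_def d_def)
  have d_nonneg: "d t \<ge> 0" for t
    by (simp add: d_def strategy_dist_eq profile_inner_self_nonneg)
  have q_nonneg: "q t \<ge> 0" for t
    by (simp add: q_def weighted_inner_self_nonneg pos)
  have w_Suc: "weighted_inner (w (Suc t)) z = weighted_inner (T (w t)) z" for t z
    by (simp add: w_def weighted_inner_T_diff)
  have "2 * q (Suc t) \<le> q t + q (Suc (Suc t))" for t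
  proof -
    \<comment> \<open>Self-adjointness shifts one application of T from the left factor to the right
      one, turning indices (t+1, t+1) into (t, t+2).\<close>
    have "q (Suc t) = weighted_inner (w t) (T (w (Suc t)))"
      by (simp add: q_def w_Suc T_self_adjoint pos)
    also have "\<dots> = weighted_inner (w t) (w (Suc (Suc t)))"
      by (metis w_Suc weighted_inner_commute)
    finally show ?thesis
      using weighted_inner_le[OF pos, of "w t" "w (Suc (Suc t))"] by (simp add: q_def)
  qed
  moreover have "\<exists>\<^sub>F t in sequentially. q t < e" if "e > 0" for e
  proof -
    define C where "C = 1 / \<eta>1 + 1 / \<eta>2"
    have "C > 0" using pos by (simp add: C_def add_pos_pos)
    \<comment> \<open>Chosen so that \<open>C * r^2 = e\<close>.\<close>
    define r where "r = sqrt (e / C)"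
    have "r > 0" using that \<open>C > 0\<close> by (simp add: r_def)
    have "\<exists>\<^sub>F t in sequentially. d t < r"
    proof (rule ccontr)
      assume "\<not> (\<exists>\<^sub>F t in sequentially. d t < r)"
      then have "\<forall>\<^sub>F t in sequentially. ereal r \<le> ereal (d t)"
        by (simp add: not_frequently not_less)
      then have "ereal r \<le> liminf (\<lambda>t. ereal (d t))" by (rule Liminf_bounded)
      then show False using inf \<open>r > 0\<close> by simp
    qed
    then show ?thesis
    proof (rule frequently_elim1)
      fix t assume "d t < r"
      then have "(d t)\<^sup>2 < r\<^sup>2" using d_nonneg by (simp add: power_strict_mono)
      then have "C * (d t)\<^sup>2 < e"
        using \<open>C > 0\<close> that by (simp add: r_def field_simps)
      then show "q t < e"
        using weighted_inner_le_dist[OF pos, of "(T ^^ t) u" "(T ^^ t) v"]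
        unfolding q_def w_def d_def C_def by (rule le_less_trans[rotated])
    qed
  qed
  ultimately have "q \<longlonglongrightarrow> 0"
    by (intro convex_seq_tendsto_zero q_nonneg)
  then have "(\<lambda>t. sqrt ((\<eta>1 + \<eta>2) * q t)) \<longlonglongrightarrow> sqrt ((\<eta>1 + \<eta>2) * 0)"
    by (intro tendsto_intros)
  then have lim: "(\<lambda>t. sqrt ((\<eta>1 + \<eta>2) * q t)) \<longlonglongrightarrow> 0" by simp
  have d_le: "d t \<le> sqrt ((\<eta>1 + \<eta>2) * q t)" for t
    unfolding d_def q_def w_def by (rule dist_le_weighted_inner[OF pos])
  have "d \<longlonglongrightarrow> 0"
    by (rule tendsto_sandwich[OF _ _ tendsto_const lim]) (simp_all add: d_nonneg d_le)
  then have "(\<lambda>t. ereal (d t)) \<longlonglongrightarrow> ereal 0" by simp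
  then have "limsup (\<lambda>t. ereal (d t)) = ereal 0" by (intro lim_imp_Limsup) simp_all
  then show False using sup by simp
qed

end

section \<open>Points have Lebesgue measure zero\<close>

text \<open>By extensionality a singleton is a product of singletons at both levels, so its measure
  is a product of zeros. The lower bounds on \<open>r\<close> and \<open>d i\<close> exclude empty
  products, which equal 1.\<close>

lemma profile_borel_singleton_null:
  assumes "r \<ge> 1" "\<And>i. i \<in> {1..r} \<Longrightarrow> d i \<ge> 1" and X: "X \<in> profile_space r d"
  shows "{X} \<in> null_sets (profile_borel r d)"
proof -
  let ?M = "\<lambda>i. \<Pi>\<^sub>M a\<in>{1..d i}. (lborel :: real measure)"
  interpret L: product_sigma_finite "\<lambda>a::nat. lborel :: real measure"
    by standard
  \<comment> \<open>The measures of the single players are sigma-finite products themselves, so the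
    product formula also applies at the outer level.\<close>
  interpret product_sigma_finite ?M
    by (intro product_sigma_finite.intro L.sigma_finite) simp
  have ext: "X i \<in> extensional {1..d i}" if "i \<in> {1..r}" for i
    using X that by (auto simp: profile_space_def PiE_def)
  have inner: "{X i} = (\<Pi>\<^sub>E a\<in>{1..d i}. {X i a})" if "i \<in> {1..r}" for i
    using ext[OF that] by (rule PiE_singleton[symmetric])
  have sets: "{X i} \<in> sets (?M i)" if "i \<in> {1..r}" for i
    unfolding inner[OF that] by (intro sets_PiM_I_finite) auto
  have null: "emeasure (?M i) {X i} = 0" if "i \<in> {1..r}" for i
  proof -
    have "d i \<ge> 1" using assms that by blast
    then show ?thesis
      unfolding inner[OF that] by (subst L.emeasure_PiM) auto
  qed
  have outer: "{X} = (\<Pi>\<^sub>E i\<in>{1..r}. {X i})"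
    using X by (intro PiE_singleton[symmetric]) (auto simp: profile_space_def PiE_def)
  have "{X} \<in> sets (profile_borel r d)"
    unfolding outer profile_borel_def using sets by (intro sets_PiM_I_finite) auto
  moreover have "emeasure (profile_borel r d) {X} = 0"
    unfolding outer profile_borel_def using sets null assms(1) by (subst emeasure_PiM) auto
  ultimately show ?thesis by (rule null_setsI[rotated])
qed

lemma sigma_finite_profile_borel: "sigma_finite_measure (profile_borel r d)"
proof -
  interpret L: product_sigma_finite "\<lambda>a::nat. lborel :: real measure"
    by standard
  interpret product_sigma_finite "\<lambda>i. \<Pi>\<^sub>M a\<in>{1..d i}. (lborel :: real measure)"
    by (intro product_sigma_finite.intro L.sigma_finite) simp
  show ?thesis unfolding profile_borel_def by (rule sigma_finite) simp
qed

text \<open>The point is a rectangle with null sides, and null sets stay null in the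
  completion.\<close>

lemma strategy_lebesgue_singleton_null:
  assumes "n \<ge> 1" "\<And>i. i \<in> {1..n} \<Longrightarrow> k i \<ge> 1" "m \<ge> 1" "\<And>j. j \<in> {1..m} \<Longrightarrow> l j \<ge> 1"
    and "u \<in> strategy_space n m k l"
  shows "{u} \<in> null_sets (strategy_lebesgue n m k l)"
proof -
  interpret sigma_finite_measure "profile_borel m l" by (rule sigma_finite_profile_borel)
  have X: "{fst u} \<in> null_sets (profile_borel n k)" and Y: "{snd u} \<in> null_sets (profile_borel m l)"
    using assms(5) profile_borel_singleton_null[OF assms(1,2)] profile_borel_singleton_null[OF assms(3,4)]
    by (simp_all add: strategy_space_def mem_Times_iff)
  have "emeasure (profile_borel n k \<Otimes>\<^sub>M profile_borel m l) ({fst u} \<times> {snd u}) = 0"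
    using X Y by (subst emeasure_pair_measure_Times) (auto dest: null_setsD1)
  moreover have "{fst u} \<times> {snd u} \<in> sets (profile_borel n k \<Otimes>\<^sub>M profile_borel m l)"
    using X Y by (intro pair_measureI) auto
  ultimately have "{u} \<in> null_sets (profile_borel n k \<Otimes>\<^sub>M profile_borel m l)"
    by (simp add: null_sets_def)
  then show ?thesis unfolding strategy_lebesgue_def by (rule null_sets_completionI)
qed

theorem theorem4p3:
  fixes n m :: nat and k l :: "nat \<Rightarrow> nat"
    and A :: "nat \<Rightarrow> nat \<Rightarrow> nat \<Rightarrow> nat \<Rightarrow> real"
    and \<eta>1 \<eta>2 :: real
    and S :: "(profile \<times> profile) set"
  assumes "n \<ge> 1" and "m \<ge> 1"
    and "\<And>i. i \<in> {1..n} \<Longrightarrow> k i \<ge> 1" and "\<And>j. j \<in> {1..m} \<Longrightarrow> l j \<ge> 1"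
    and "\<eta>1 > 0" and "\<eta>2 > 0"
    and "S \<subseteq> strategy_space n m k l"
    and "scrambled_set (strategy_dist n m k l) (alt_gradient n m k l A \<eta>1 \<eta>2) S"
  shows "S \<in> null_sets (strategy_lebesgue n m k l)"
proof (cases "S = {}")
  case False
  then obtain u where u: "u \<in> S" by blast
  have "v = u" if "v \<in> S" for v
    using assms(8) u that not_scrambled_pair[OF assms(5,6)] unfolding scrambled_set_def by blast
  then have "S = {u}" using u by blast
  \<comment> \<open>The index ranges are nonempty, so the space has positive dimension and a point
    is null.\<close>
  moreover have "{u} \<in> null_sets (strategy_lebesgue n m k l)"
    using assms(7) u by (intro strategy_lebesgue_singleton_null assms(1-4)) blast+
  ultimately show ?thesis by simp
qed simp

end
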